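(* Let $n\ge 2$, let $P=(p_1,\dots,p_n)$ and $Q=(q_1,\dots,q_n)$ be elements of $\Gamma_n$, and let $r,R$ be real numbers with $0<r\le \frac{p_i}{q_i}\le R<\infty$ for all $i\in\{1,\dots,n\}$. Then $$\frac{R+1}{8R}\,\Delta(P\|Q)\le F(P\|Q)\le \frac{r+1}{8r}\,\Delta(P\|Q).$$
   Context: $\Gamma_n=\{P=(p_1,\dots,p_n): p_i>0,\ \sum_{i=1}^n p_i=1\}$ is the set of finite discrete probability distributions with strictly positive entries. $\ln$ is the natural logarithm. The relative Jensen-Shannon divergence is $F(P\|Q)=\sum_{i=1}^n p_i\ln\left(\frac{2p_i}{p_i+q_i}\right)$. The triangular discrimination is $\Delta(P\|Q)=\sum_{i=1}^n \frac{(p_i-q_i)^2}{p_i+q_i}$. *)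

theory Defs
  imports Complex_Main
begin

text \<open>An $n$-tuple is a function \<open>nat \<Rightarrow> real\<close> of which only the values
  at the indices $1, \ldots, n$ matter; the values elsewhere are left unconstrained.\<close>

definition Gamma_dist :: "nat \<Rightarrow> (nat \<Rightarrow> real) set" where
  "Gamma_dist n = {P. (\<forall>i\<in>{1..n}. 0 < P i) \<and> (\<Sum>i = 1..n. P i) = 1}"

definition rel_JS_div :: "nat \<Rightarrow> (nat \<Rightarrow> real) \<Rightarrow> (nat \<Rightarrow> real) \<Rightarrow> real" where
  "rel_JS_div n P Q = (\<Sum>i = 1..n. P i * ln (2 * P i / (P i + Q i)))"

definition triangular_disc :: "nat \<Rightarrow> (nat \<Rightarrow> real) \<Rightarrow> (nat \<Rightarrow> real) \<Rightarrow> real" where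
  "triangular_disc n P Q = (\<Sum>i = 1..n. (P i - Q i)\<^sup>2 / (P i + Q i))"

end

theory Submission imports Defs "HOL-Analysis.Convex"
begin

text \<open>Both divergences are \<open>f\<close>-divergences, generated by
  \<open>f t = t * ln (2 * t / (t + 1))\<close> and \<open>g t = (t - 1)\<^sup>2 / (t + 1)\<close>. Since
  \<open>f'' t = (t + 1) / (8 * t) * g'' t\<close> and \<open>(t + 1) / (8 * t)\<close> decreases in \<open>t\<close>,
  on \<open>[r, R]\<close> the function \<open>f - c * g\<close> is convex for \<open>c = (R + 1) / (8 * R)\<close> and concave for
  \<open>c = (r + 1) / (8 * r)\<close>. Comparing it with its tangent \<open>(t - 1) / 2\<close> at \<open>t = 1\<close> and summing
  with weights \<open>q\<^sub>i\<close>, the tangent contributes \<open>0\<close>. The point \<open>1\<close> lies in \<open>[r, R]\<close> because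
  \<open>P\<close> and \<open>Q\<close> have equal mass.\<close>

text \<open>The sign \<open>s\<close> treats the lower and the upper bound simultaneously.\<close>

lemma generator_tangent_bound:
  fixes C :: "real set" and s c t :: real
  assumes "convex C" "C \<subseteq> {0<..}" "1 \<in> C" "t \<in> C"
    and ratio: "\<And>x. x \<in> C \<Longrightarrow> 0 \<le> s * ((x + 1) / (8 * x) - c)"
  shows "s * (c * ((t - 1)\<^sup>2 / (t + 1)) + (t - 1) / 2) \<le> s * (t * ln (2 * t / (t + 1)))"
proof -
  define h where "h x = s * (x * ln (2 * x / (x + 1)) - c * ((x - 1)\<^sup>2 / (x + 1)))" for x
  \<comment> \<open>The last bracket is the derivative of
    \<open>(x - 1)\<^sup>2 / (x + 1) = x - 3 + 4 / (x + 1)\<close>.\<close>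
  define h' where
    "h' x = s * (ln (2 * x / (x + 1)) + 1 / (x + 1) - c * (1 - 4 / (x + 1)\<^sup>2))" for x
  \<comment> \<open>The second derivative of \<open>(x - 1)\<^sup>2 / (x + 1)\<close> is factored
    out; it is positive on \<open>C\<close>, so \<open>ratio\<close> alone decides the sign.\<close>
  define h'' where "h'' x = 8 / (x + 1) ^ 3 * (s * ((x + 1) / (8 * x) - c))" for x
  have pos: "x > 0" if "x \<in> C" for x
    using that assms(2) by auto
  \<comment> \<open>Convexity puts \<open>h\<close> above its tangent at \<open>1\<close>. There
    \<open>h 1 = 0\<close> and \<open>h' 1 = s / 2\<close>, whatever \<open>c\<close> is.\<close>
  have "h' 1 * (t - 1) \<le> h t - h 1"
  proof (rule f''_imp_f'[where f = h and f'' = h'', OF \<open>convex C\<close>])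
    fix x assume "x \<in> C"
    then have x: "x > 0" by (rule pos)
    have ln: "((\<lambda>x. ln (2 * x / (x + 1))) has_real_derivative 1 / x - 1 / (x + 1)) (at x)"
    proof (rule DERIV_cong)
      have "((\<lambda>x. 2 * x / (x + 1)) has_real_derivative 2 / (x + 1)\<^sup>2) (at x)"
        using x by (auto intro!: derivative_eq_intros simp: power2_eq_square field_simps)
      then show "((\<lambda>x. ln (2 * x / (x + 1))) has_real_derivative
          1 / (2 * x / (x + 1)) * (2 / (x + 1)\<^sup>2)) (at x)"
        using x by (intro DERIV_chain2[OF DERIV_ln_divide]) auto
      show "1 / (2 * x / (x + 1)) * (2 / (x + 1)\<^sup>2) = 1 / x - 1 / (x + 1)"
        using x by (simp add: divide_simps) (simp add: power2_eq_square algebra_simps)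
    qed
    have inv: "((\<lambda>x. 1 / (x + 1)) has_real_derivative - 1 / (x + 1)\<^sup>2) (at x)"
      using x by (auto intro!: derivative_eq_intros simp: power2_eq_square)
    have inv2: "((\<lambda>x. 4 / (x + 1)\<^sup>2) has_real_derivative - 8 / (x + 1) ^ 3) (at x)"
      using x by (auto intro!: derivative_eq_intros
          simp: divide_simps power2_eq_square power3_eq_cube)
    have g: "((\<lambda>x. (x - 1)\<^sup>2 / (x + 1)) has_real_derivative 1 - 4 / (x + 1)\<^sup>2) (at x)"
    proof (rule DERIV_cong)
      show "((\<lambda>x. (x - 1)\<^sup>2 / (x + 1)) has_real_derivative
          (2 * (x - 1) * (x + 1) - (x - 1)\<^sup>2 * 1) / ((x + 1) * (x + 1))) (at x)"
        using x by (intro DERIV_divide) (auto intro!: derivative_eq_intros)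
      show "(2 * (x - 1) * (x + 1) - (x - 1)\<^sup>2 * 1) / ((x + 1) * (x + 1)) = 1 - 4 / (x + 1)\<^sup>2"
        using x by (simp add: divide_simps) (simp add: power2_eq_square algebra_simps)
    qed
    show "DERIV h x :> h' x"
      unfolding h_def h'_def
    proof (intro DERIV_cmult DERIV_diff g, rule DERIV_cong[OF DERIV_mult[OF DERIV_ident ln]])
      show "1 * ln (2 * x / (x + 1)) + (1 / x - 1 / (x + 1)) * x = ln (2 * x / (x + 1)) + 1 / (x + 1)"
        using x by (simp add: divide_simps)
    qed
    have "((\<lambda>x. s * (ln (2 * x / (x + 1)) + 1 / (x + 1) - c * (1 - 4 / (x + 1)\<^sup>2)))
        has_real_derivative
        s * (1 / x - 1 / (x + 1) + - 1 / (x + 1)\<^sup>2 - c * (0 - (- 8 / (x + 1) ^ 3)))) (at x)"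
      by (intro DERIV_cmult DERIV_diff DERIV_add DERIV_const ln inv inv2)
    moreover have "1 / x - 1 / (x + 1) + - 1 / (x + 1)\<^sup>2 - c * (0 - (- 8 / (x + 1) ^ 3))
        = 8 / (x + 1) ^ 3 * ((x + 1) / (8 * x) - c)"
    proof -
      \<comment> \<open>Both sides equal \<open>1 / (x * (x + 1)\<^sup>2)\<close>.\<close>
      have "1 / x - 1 / (x + 1) + - 1 / (x + 1)\<^sup>2 = 8 / (x + 1) ^ 3 * ((x + 1) / (8 * x))"
        using x by (simp add: divide_simps) (simp add: power2_eq_square power3_eq_cube algebra_simps)
      then show ?thesis by (simp add: right_diff_distrib)
    qed
    ultimately show "DERIV h' x :> h'' x"
      unfolding h'_def h''_def by (simp only: mult.left_commute)
    show "h'' x \<ge> 0"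
      unfolding h''_def using x ratio[OF \<open>x \<in> C\<close>] by simp
  qed (use assms in auto)
  then show ?thesis
    by (simp add: h_def h'_def algebra_simps)
qed

text \<open>The tangent bound at \<open>t = P i / Q i\<close>, multiplied by \<open>Q i > 0\<close>,
  becomes a bound between the summands; its linear part becomes \<open>s * (P i - Q i) / 2\<close>,
  which cancels in the sum.\<close>

lemma sum_generator_bound:
  fixes P Q :: "nat \<Rightarrow> real"
  assumes P: "P \<in> Gamma_dist n" and Q: "Q \<in> Gamma_dist n"
    and "convex C" "C \<subseteq> {0<..}" "1 \<in> C"
    and mem: "\<And>i. i \<in> {1..n} \<Longrightarrow> P i / Q i \<in> C"
    and ratio: "\<And>x. x \<in> C \<Longrightarrow> 0 \<le> s * ((x + 1) / (8 * x) - c)"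
  shows "s * (c * triangular_disc n P Q) \<le> s * rel_JS_div n P Q"
proof -
  have "(\<Sum>i = 1..n. s * (c * ((P i - Q i)\<^sup>2 / (P i + Q i)) + (P i - Q i) / 2))
      \<le> (\<Sum>i = 1..n. s * (P i * ln (2 * P i / (P i + Q i))))"
  proof (rule sum_mono)
    fix i assume i: "i \<in> {1..n}"
    define t where "t = P i / Q i"
    have q: "Q i > 0" "P i > 0"
      using i P Q by (auto simp: Gamma_dist_def)
    have p: "P i = t * Q i" and t: "t > 0"
      using q by (simp_all add: t_def)
    have "s * (c * ((t - 1)\<^sup>2 / (t + 1)) + (t - 1) / 2) * Q i
        \<le> s * (t * ln (2 * t / (t + 1))) * Q i"
      using generator_tangent_bound[of C t s c] assms(3-5) mem[OF i] ratio q
      by (intro mult_right_mono) (auto simp: t_def)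
    moreover have sum: "P i + Q i = (t + 1) * Q i"
      by (simp add: p algebra_simps)
    have "2 * P i / (P i + Q i) = 2 * t / (t + 1)"
      unfolding sum using q by (simp add: p)
    moreover have "(P i - Q i)\<^sup>2 / (P i + Q i) = (t - 1)\<^sup>2 / (t + 1) * Q i"
    proof -
      have "P i - Q i = (t - 1) * Q i"
        by (simp add: p algebra_simps)
      then show ?thesis
        unfolding sum using q by (simp add: power2_eq_square)
    qed
    ultimately show "s * (c * ((P i - Q i)\<^sup>2 / (P i + Q i)) + (P i - Q i) / 2)
        \<le> s * (P i * ln (2 * P i / (P i + Q i)))"
      by (simp add: p algebra_simps diff_divide_distrib)
  qed
  moreover have "(\<Sum>i = 1..n. (P i - Q i) / 2) = 0"
    using P Q by (simp add: Gamma_dist_def sum_subtractf flip: sum_divide_distrib)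
  ultimately show ?thesis
    unfolding triangular_disc_def rel_JS_div_def sum_distrib_left[symmetric] sum.distrib by simp
qed

text \<open>Clearing denominators and summing over \<open>i\<close> leaves
  \<open>r \<le> 1 \<le> R\<close>, as both total masses are \<open>1\<close>. This makes
  \<open>1\<close> an admissible point of tangency.\<close>

lemma one_between_ratio_bounds:
  assumes P: "P \<in> Gamma_dist n" and Q: "Q \<in> Gamma_dist n"
    and bounds: "\<And>i. i \<in> {1..n} \<Longrightarrow> r \<le> P i / Q i \<and> P i / Q i \<le> R"
  shows "1 \<in> {r..R}"
proof -
  have "r * Q i \<le> P i \<and> P i \<le> R * Q i" if "i \<in> {1..n}" for i
  proof -
    have "Q i > 0"
      using Q that by (auto simp: Gamma_dist_def)
    then show ?thesis
      using bounds[OF that] by (simp add: field_simps)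
  qed
  then have "(\<Sum>i = 1..n. r * Q i) \<le> (\<Sum>i = 1..n. P i)"
      "(\<Sum>i = 1..n. P i) \<le> (\<Sum>i = 1..n. R * Q i)"
    by (auto intro!: sum_mono)
  then show ?thesis
    using P Q by (simp add: Gamma_dist_def flip: sum_distrib_left)
qed

theorem proposition5p1:
  fixes n :: nat and P Q :: "nat \<Rightarrow> real" and r R :: real
  assumes "n \<ge> 2"
    and "P \<in> Gamma_dist n" and "Q \<in> Gamma_dist n"
    and "0 < r"
    and "\<And>i. i \<in> {1..n} \<Longrightarrow> r \<le> P i / Q i \<and> P i / Q i \<le> R"
  shows "(R + 1) / (8 * R) * triangular_disc n P Q \<le> rel_JS_div n P Q \<and>
         rel_JS_div n P Q \<le> (r + 1) / (8 * r) * triangular_disc n P Q"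
proof -
  have one: "1 \<in> {r..R}"
    using assms(2,3,5) by (rule one_between_ratio_bounds)
  have mem: "P i / Q i \<in> {r..R}" if "i \<in> {1..n}" for i
    using assms(5)[OF that] by simp
  have sub: "{r..R} \<subseteq> {0<..}"
    using \<open>0 < r\<close> by auto
  \<comment> \<open>The quotient is \<open>1 / 8 + 1 / (8 * x)\<close>, so on \<open>{r..R}\<close>
    it is smallest at \<open>R\<close> and largest at \<open>r\<close>.\<close>
  have antimono: "(y + 1) / (8 * y) \<le> (x + 1) / (8 * x)" if "0 < x" "x \<le> y" for x y :: real
    using that by (simp add: field_simps)
  note bound = sum_generator_bound[OF assms(2,3) convex_real_interval(5) sub one mem]
  \<comment> \<open>Here \<open>s = 1\<close> and \<open>c\<close> is the minimum of the
    quotient.\<close>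
  have "1 * ((R + 1) / (8 * R) * triangular_disc n P Q) \<le> 1 * rel_JS_div n P Q"
    by (rule bound) (use \<open>0 < r\<close> antimono in auto)
  \<comment> \<open>Here \<open>s = -1\<close> and \<open>c\<close> is the maximum; the sign
    reverses the inequality.\<close>
  moreover have "-1 * ((r + 1) / (8 * r) * triangular_disc n P Q) \<le> -1 * rel_JS_div n P Q"
    by (rule bound) (use \<open>0 < r\<close> antimono in auto)
  ultimately show ?thesis by simp
qed

end
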